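(* Let $n \ge 1$ be an integer and let $x,y \in [0,\infty)^n$ with $\sum_{i=1}^n x_i = \sum_{i=1}^n y_i$. Then the following three properties are equivalent: (a) $x \succ y$; (b) $G_{k,r}(x) \leq G_{k,r}(y)$ for all integers $k,r \geq 1$; (c) $M_{k,r}(x) \geq M_{k,r}(y)$ for all integers $k,r \geq 1$.
   Context: Majorization: for $x,y \in [0,\infty)^n$, $x \succ y$ means that $\sum_{i=1}^n x_i = \sum_{i=1}^n y_i$ and $\sum_{i=1}^k x_i^* \geq \sum_{i=1}^k y_i^*$ for $k=1,\dots,n-1$, where $x_1^* \geq \dots \geq x_n^*$ denotes the decreasing rearrangement of the entries of a vector $x$. For integers $k,r \geq 1$ and $x=(x_1,\dots,x_n) \in [0,\infty)^n$, define $$G_{k,r}(x) := \sum_{p \in S_{k,r}} \ \prod_{i=1}^n \frac{x_i^{p_i}}{p_i!},$$ where $S_{k,r}$ is the set of all $p=(p_1,\dots,p_n) \in \mathbb{Z}^n$ such that $p_i \geq 0$ for all $i$, $\sum_{i=1}^n p_i = k$, and $p$ has at least $r$ nonzero entries (with the convention $x_i^0 = 1$; an empty sum is $0$, so e.g. $G_{k,r}=0$ if $k<r$). Also define $$M_{k,r}(x) := \sum_{1\leq i_1 < \dots < i_r \leq n} (x_{i_1} + \dots + x_{i_r})^k,$$ with $M_{k,r}(x)=0$ if $r>n$ (empty sum). *)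

theory Defs
  imports "HOL-Analysis.Analysis" "HOL-Library.Multiset"
begin

definition decr :: "real ^ 'n \<Rightarrow> real list" where
  "decr x = rev (sorted_list_of_multiset {# x $ i. i \<in># mset_set UNIV #})"

lemma mset_decr: "mset (decr x) = {# x $ i. i \<in># mset_set UNIV #}"
  by (simp add: decr_def)

lemma length_decr: "length (decr (x :: real ^ 'n)) = CARD('n)"
  by (metis mset_decr size_image_mset size_mset size_mset_set)

lemma sorted_decr: "sorted_wrt (\<ge>) (decr x)"
  by (simp add: decr_def sorted_wrt_rev)

text \<open>The list is indexed from 0, so the sum of the \<open>k\<close> largest entries ranges over \<open>j < k\<close>.\<close>

definition majorizes :: "real ^ 'n \<Rightarrow> real ^ 'n \<Rightarrow> bool" (infix "\<succ>" 50) where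
  "x \<succ> y \<longleftrightarrow>
     (\<Sum>i\<in>UNIV. x $ i) = (\<Sum>i\<in>UNIV. y $ i) \<and>
     (\<forall>k\<in>{1..<CARD('n)}. (\<Sum>j<k. decr x ! j) \<ge> (\<Sum>j<k. decr y ! j))"

definition S :: "nat \<Rightarrow> nat \<Rightarrow> ('n :: finite \<Rightarrow> nat) set" where
  "S k r = {p. (\<Sum>i\<in>UNIV. p i) = k \<and> card {i. p i \<noteq> 0} \<ge> r}"

lemma finite_S: "finite (S k r :: ('n :: finite \<Rightarrow> nat) set)"
proof (rule finite_subset)
  show "S k r \<subseteq> (UNIV \<rightarrow>\<^sub>E {..k} :: ('n \<Rightarrow> nat) set)"
    by (auto simp: S_def intro: member_le_sum)
  show "finite (UNIV \<rightarrow>\<^sub>E {..k} :: ('n \<Rightarrow> nat) set)"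
    by (intro finite_PiE) auto
qed

definition G :: "nat \<Rightarrow> nat \<Rightarrow> real ^ 'n \<Rightarrow> real" where
  "G k r x = (\<Sum>p\<in>S k r. \<Prod>i\<in>UNIV. (x $ i) ^ p i / fact (p i))"

text \<open>Index tuples \<open>i\<^sub>1 < \<dots> < i\<^sub>r\<close> correspond to the \<open>r\<close>-element sets of indices.\<close>

definition M :: "nat \<Rightarrow> nat \<Rightarrow> real ^ 'n \<Rightarrow> real" where
  "M k r x = (\<Sum>I | I \<subseteq> (UNIV :: 'n set) \<and> card I = r. (\<Sum>i\<in>I. x $ i) ^ k)"

end

theory Submission
  imports Defs "HOL-Combinatorics.Permutations"
begin

text \<open>
  Majorization is probed through blends (T-transforms): replace the entries \<open>z\<^sub>i\<close> and \<open>z\<^sub>j\<close> by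
  \<open>(1 - t) z\<^sub>i + t z\<^sub>j\<close> and \<open>(1 - t) z\<^sub>j + t z\<^sub>i\<close> with \<open>0 \<le> t \<le> 1\<close>. By the theorem of Hardy,
  Littlewood and Polya, finitely many blends lead from \<open>x\<close> to \<open>y\<close> when \<open>x \<succ> y\<close>. So a function that no
  blend increases is larger at \<open>x\<close> than at \<open>y\<close> (\<open>majorization_imp_blending_le\<close>), and the forward
  implications reduce to one blend.

  For \<open>M\<close> this is convexity together with symmetry: a blend is a convex combination of \<open>z\<close> and of
  \<open>z\<close> with two entries exchanged. For \<open>G\<close>, fix all exponents except \<open>p\<^sub>i\<close> and \<open>p\<^sub>j\<close>, and fix
  \<open>m = p\<^sub>i + p\<^sub>j\<close>. The constraint on the number of nonzero exponents then leaves no pair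
  \<open>(p\<^sub>i, p\<^sub>j)\<close>, all of them, or exactly those with both entries positive. With \<open>a = z\<^sub>i\<close> and
  \<open>b = z\<^sub>j\<close>, the sum over the pairs is \<open>0\<close>, \<open>(a + b)\<^sup>m / m!\<close> or
  \<open>((a + b)\<^sup>m - a\<^sup>m - b\<^sup>m) / m!\<close>. A blend keeps \<open>a + b\<close> and does not increase \<open>a\<^sup>m + b\<^sup>m\<close>.

  For the converses let \<open>r\<close> be less than the dimension and let \<open>k\<close> grow: up to a factor independent of \<open>k\<close>, \<open>M k r x\<close> is the \<open>k\<close>-th
  power of the sum of the \<open>r\<close> largest entries of \<open>x\<close>. The same holds for \<open>k!\<close> times the part of
  the multinomial expansion of \<open>(x\<^sub>1 + \<dots> + x\<^sub>n)\<^sup>k / k!\<close> that \<open>G k (r + 1) x\<close> omits, namely the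
  exponents with at most \<open>r\<close> nonzero entries (\<open>G_complement\<close>, \<open>few_nonzero_bounds\<close>). Both families
  of inequalities therefore bound \<open>(\<Sum>l\<in>I. y\<^sub>l)\<^sup>k\<close> by \<open>M k r x\<close> for every \<open>r\<close>-element \<open>I\<close>, and
  \<open>k \<rightarrow> \<infinity>\<close> compares the sums of the \<open>r\<close> largest entries (\<open>majorization_of_power_bounds\<close>).
\<close>

section \<open>Blends and majorization\<close>

definition blend :: "real \<Rightarrow> 'n \<Rightarrow> 'n \<Rightarrow> real ^ 'n \<Rightarrow> real ^ 'n" where
  "blend t i j z = (\<chi> l. (1 - t) * z $ l + t * z $ Transposition.transpose i j l)"

definition decreases_under_blending :: "(real ^ 'n \<Rightarrow> real) \<Rightarrow> bool" where
  "decreases_under_blending F \<longleftrightarrow>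
     (\<forall>z t i j. (\<forall>l. 0 \<le> z $ l) \<longrightarrow> 0 \<le> t \<longrightarrow> t \<le> 1 \<longrightarrow> i \<noteq> j \<longrightarrow> F (blend t i j z) \<le> F z)"

lemma decreases_under_blendingD:
  assumes "decreases_under_blending F" "\<And>l. 0 \<le> z $ l" "0 \<le> t" "t \<le> 1" "i \<noteq> j"
  shows "F (blend t i j z) \<le> F z"
  using assms unfolding decreases_under_blending_def by blast

lemma blend_nth_eq:
  assumes "i \<noteq> j"
  shows "blend t i j z $ i = (1 - t) * z $ i + t * z $ j"
    and "blend t i j z $ j = (1 - t) * z $ j + t * z $ i"
    and "l \<noteq> i \<Longrightarrow> l \<noteq> j \<Longrightarrow> blend t i j z $ l = z $ l"
  by (auto simp: blend_def algebra_simps)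

lemma blend_one: "blend 1 i j z = (\<chi> l. z $ Transposition.transpose i j l)"
  by (simp add: blend_def)

text \<open>The blend with \<open>t = 1\<close> exchanges two entries, and exchanging them again restores the vector;
  so symmetry is a consequence of monotonicity under blends.\<close>

lemma blending_invariant_swap:
  assumes F: "decreases_under_blending F" and z: "\<And>l. 0 \<le> z $ l"
  shows "F (\<chi> l. z $ Transposition.transpose i j l) = F z"
proof (cases "i = j")
  case False
  let ?w = "\<chi> l. z $ Transposition.transpose i j l"
  have "F (blend 1 i j z) \<le> F z" "F (blend 1 i j ?w) \<le> F ?w"
    using decreases_under_blendingD[OF F, of _ 1 i j] z False by auto
  then show ?thesis by (simp add: blend_one)
qed simp

lemma blending_invariant_permutation:
  fixes z :: "real ^ 'n"
  assumes F: "decreases_under_blending F" and z: "\<And>l. 0 \<le> z $ l" and p: "bij p"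
  shows "F (\<chi> l. z $ p l) = F z"
proof -
  have "p permutes UNIV"
    using p by (simp add: permutes_univ bij_iff)
  then show ?thesis
    using finite[of "UNIV :: 'n set"] z
  proof (induction arbitrary: z rule: permutes_induct)
    case id
    then show ?case by simp
  next
    case (swap a b p)
    have "F (\<chi> l. z $ Transposition.transpose a b (p l))
        = F (\<chi> l. (\<chi> m. z $ Transposition.transpose a b m) $ p l)"
      by simp
    also have "\<dots> = F (\<chi> m. z $ Transposition.transpose a b m)"
      using swap.IH[of "\<chi> m. z $ Transposition.transpose a b m"] swap.prems by simp
    also have "\<dots> = F z"
      using blending_invariant_swap[OF F] swap.prems by blast
    finally show ?case by simp
  qed
qed

text \<open>
  This is the step of Hardy, Littlewood and Polya: take a position \<open>k\<close> where \<open>x\<close> is too small and an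
  earlier position \<open>j\<close> where it is too large, and blend these two entries until one of them agrees
  with \<open>y\<close>. This shrinks the set of entries in which \<open>x\<close> and \<open>y\<close> differ. Only \<open>y\<close> is listed in
  decreasing order by \<open>e\<close>; the induction would not preserve such an assumption on \<open>x\<close>.
\<close>

lemma blending_mono_of_prefix_sums:
  fixes x y :: "real ^ 'n"
  assumes F: "decreases_under_blending F"
    and e: "bij_betw e {..<CARD('n)} UNIV"
    and y0: "\<And>l. 0 \<le> y $ l"
    and y_decr: "\<And>a b. a \<le> b \<Longrightarrow> b < CARD('n) \<Longrightarrow> y $ e b \<le> y $ e a"
    and "\<And>l. 0 \<le> x $ l"
    and "\<And>m. m < CARD('n) \<Longrightarrow> (\<Sum>a<m. y $ e a) \<le> (\<Sum>a<m. x $ e a)"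
    and "(\<Sum>a<CARD('n). x $ e a) = (\<Sum>a<CARD('n). y $ e a)"
  shows "F y \<le> F x"
  using assms(5-)
proof (induction "card {l. x $ l \<noteq> y $ l}" arbitrary: x rule: less_induct)
  case less
  let ?n = "CARD('n)"
  note x0 = less.prems(1) and tot = less.prems(3)
  have dom: "(\<Sum>a<m. y $ e a) \<le> (\<Sum>a<m. x $ e a)" if "m \<le> ?n" for m
    using less.prems that by (cases "m = ?n") auto
  show ?case
  proof (cases "x = y")
    case False
    have ex: "\<exists>a<?n. x $ e a < y $ e a"
    proof (rule ccontr)
      assume "\<not> ?thesis"
      then have le: "y $ e a \<le> x $ e a" if "a \<in> {..<?n}" for a
        using that by force
      have eq: "y $ e a = x $ e a" if "a \<in> {..<?n}" for a
        by (rule sum_mono_inv[OF tot[symmetric] le that]) simp_all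
      have "x $ l = y $ l" for l
      proof -
        obtain a where "a \<in> {..<?n}" "l = e a"
          using e unfolding bij_betw_def by blast
        then show ?thesis using eq by simp
      qed
      with False show False by (simp add: vec_eq_iff)
    qed
    \<comment> \<open>Leastness makes \<open>x - y\<close> nonnegative before \<open>k\<close>, which is what keeps the prefix sums dominant
      after the transfer from \<open>j\<close> to \<open>k\<close>.\<close>
    define k where "k = (LEAST a. a < ?n \<and> x $ e a < y $ e a)"
    have k: "k < ?n" "x $ e k < y $ e k"
      using LeastI_ex[OF ex] unfolding k_def by auto
    have kmin: "y $ e a \<le> x $ e a" if "a < k" for a
      using not_less_Least[of a "\<lambda>a. a < ?n \<and> x $ e a < y $ e a"] that k(1)
      unfolding k_def by force
    have "\<exists>a<k. y $ e a < x $ e a"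
    proof (rule ccontr)
      assume "\<not> ?thesis"
      then have "(\<Sum>a<k. x $ e a) \<le> (\<Sum>a<k. y $ e a)"
        by (intro sum_mono) force
      moreover have "(\<Sum>a<Suc k. y $ e a) \<le> (\<Sum>a<Suc k. x $ e a)"
        using dom[of "Suc k"] k by simp
      ultimately show False using k by simp
    qed
    then obtain j where j: "j < k" "y $ e j < x $ e j" by blast
    have e_eq: "e a = e b \<longleftrightarrow> a = b" if "a < ?n" "b < ?n" for a b
      using bij_betw_imp_inj_on[OF e] that by (simp add: inj_on_eq_iff)
    have jk: "e j \<noteq> e k"
      using e_eq[of j k] j k by simp
    \<comment> \<open>The largest amount that overshoots neither \<open>y $ e j\<close> nor \<open>y $ e k\<close>.\<close>
    define d where "d = min (x $ e j - y $ e j) (y $ e k - x $ e k)"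
    have "y $ e k \<le> y $ e j" using y_decr j k by simp
    then have d: "0 < d" "d \<le> x $ e j - y $ e j" "d \<le> y $ e k - x $ e k"
        "d \<le> x $ e j - x $ e k" "x $ e k < x $ e j"
      using j k unfolding d_def by auto
    define t where "t = d / (x $ e j - x $ e k)"
    have t: "0 \<le> t" "t \<le> 1" "t * (x $ e j - x $ e k) = d"
      using d unfolding t_def by auto
    define x' where "x' = blend t (e j) (e k) x"
    have x'j: "x' $ e j = x $ e j - d" and x'k: "x' $ e k = x $ e k + d"
      and x'l: "\<And>l. l \<noteq> e j \<Longrightarrow> l \<noteq> e k \<Longrightarrow> x' $ l = x $ l"
      unfolding x'_def blend_nth_eq(1,2)[OF jk] t(3)[symmetric]
      using blend_nth_eq(3)[OF jk] by (auto simp: algebra_simps)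
    have sum': "(\<Sum>a<m. x' $ e a) = (\<Sum>a<m. x $ e a) - (if j < m then d else 0) + (if k < m then d else 0)"
      if "m \<le> ?n" for m
    proof -
      have "(\<Sum>a<m. x' $ e a) = (\<Sum>a<m. x $ e a - (if a = j then d else 0) + (if a = k then d else 0))"
      proof (intro sum.cong refl)
        fix a assume a: "a \<in> {..<m}"
        show "x' $ e a = x $ e a - (if a = j then d else 0) + (if a = k then d else 0)"
          using x'j x'k x'l[of "e a"] a that j k e_eq[of a j] e_eq[of a k] by auto
      qed
      then show ?thesis
        by (simp add: sum.distrib sum_subtractf)
    qed
    have "F y \<le> F x'"
    proof (rule less.hyps)
      show "card {l. x' $ l \<noteq> y $ l} < card {l. x $ l \<noteq> y $ l}"
      proof (rule psubset_card_mono)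
        have "l \<in> {l. x $ l \<noteq> y $ l}" if "l \<in> {l. x' $ l \<noteq> y $ l}" for l
          using that x'l[of l] j(2) k(2) by (cases "l = e j"; cases "l = e k") auto
        moreover have "x' $ e j = y $ e j \<or> x' $ e k = y $ e k"
          using x'j x'k unfolding d_def by auto
        moreover have "e j \<in> {l. x $ l \<noteq> y $ l}" "e k \<in> {l. x $ l \<noteq> y $ l}"
          using j(2) k(2) by auto
        ultimately show "{l. x' $ l \<noteq> y $ l} \<subset> {l. x $ l \<noteq> y $ l}"
          by blast
      qed simp
      show "0 \<le> x' $ l" for l
        using x'j x'k x'l[of l] x0[of l] d y0[of "e j"] x0[of "e k"]
        by (cases "l = e j"; cases "l = e k") auto
      show "(\<Sum>a<?n. x' $ e a) = (\<Sum>a<?n. y $ e a)"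
        using sum'[of ?n] tot j k by simp
      show "(\<Sum>a<m. y $ e a) \<le> (\<Sum>a<m. x' $ e a)" if m: "m < ?n" for m
      proof (cases "j < m \<and> m \<le> k")
        case True
        \<comment> \<open>The surplus at \<open>j\<close> alone pays for the amount \<open>d\<close> that has not yet reached \<open>k\<close>.\<close>
        have "(\<Sum>a<m. x $ e a - y $ e a) \<ge> (\<Sum>a\<in>{j}. x $ e a - y $ e a)"
          using True kmin by (intro sum_mono2) auto
        then have "(\<Sum>a<m. x $ e a) - (\<Sum>a<m. y $ e a) \<ge> x $ e j - y $ e j"
          by (simp add: sum_subtractf)
        then show ?thesis
          using sum'[of m] True d m by simp
      next
        case False
        then show ?thesis
          using sum'[of m] dom[of m] j m by auto
      qed
    qed
    also have "\<dots> \<le> F x"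
      unfolding x'_def using decreases_under_blendingD[OF F] x0 t jk by blast
    finally show ?thesis .
  qed simp
qed

text \<open>Access to \<open>decr\<close> is through an ordering of the indices rather than of the values, so that
  sums of entries become sums over sets of indices.\<close>

lemma decr_enumeration:
  fixes x :: "real ^ 'n"
  obtains e where "bij_betw e {..<CARD('n)} UNIV" "\<And>a. a < CARD('n) \<Longrightarrow> decr x ! a = x $ e a"
    "\<And>a b. a \<le> b \<Longrightarrow> b < CARD('n) \<Longrightarrow> x $ e b \<le> x $ e a"
proof -
  obtain us :: "'n list" where us: "set us = UNIV" "distinct us"
    using finite_distinct_list[OF finite[of UNIV]] by blast
  define es where "es = rev (sort_key (($) x) us)"
  have es: "set es = UNIV" "distinct es" "length es = CARD('n)"
    using us unfolding es_def by (auto simp: distinct_card[symmetric])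
  have "mset us = mset_set UNIV"
    using us by (metis mset_set_set)
  then have "sorted_list_of_multiset {# x $ i. i \<in># mset_set UNIV #} = sort (map (($) x) us)"
    by (metis mset_map sorted_list_of_multiset_mset)
  also have "\<dots> = map (($) x) (sort_key (($) x) us)"
    by (rule properties_for_sort) auto
  finally have map_es: "decr x = map (($) x) es"
    by (simp add: decr_def es_def rev_map)
  show thesis
  proof (rule that[of "(!) es"])
    show "bij_betw ((!) es) {..<CARD('n)} UNIV"
      using bij_betw_nth[of es] es by auto
    show eq: "decr x ! a = x $ (es ! a)" if "a < CARD('n)" for a
      using map_es es that by simp
    show "x $ (es ! b) \<le> x $ (es ! a)" if "a \<le> b" "b < CARD('n)" for a b
      using sorted_wrt_nth_less[OF sorted_decr, of a b x] length_decr[of x] that eq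
      by (cases "a = b") auto
  qed
qed

text \<open>The orderings \<open>e\<close> of \<open>x\<close> and \<open>e'\<close> of \<open>y\<close> differ in general; permuting the entries of \<open>x\<close> aligns them
  and leaves the value of \<open>F\<close> unchanged.\<close>

theorem majorization_imp_blending_le:
  fixes x y :: "real ^ 'n"
  assumes F: "decreases_under_blending F"
    and x0: "\<And>l. 0 \<le> x $ l" and y0: "\<And>l. 0 \<le> y $ l" and maj: "x \<succ> y"
  shows "F y \<le> F x"
proof -
  let ?n = "CARD('n)"
  obtain e where e: "bij_betw e {..<?n} UNIV" "\<And>a. a < ?n \<Longrightarrow> decr x ! a = x $ e a"
    "\<And>a b. a \<le> b \<Longrightarrow> b < ?n \<Longrightarrow> x $ e b \<le> x $ e a"
    using decr_enumeration[of x] by blast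
  obtain e' where e': "bij_betw e' {..<?n} UNIV" "\<And>a. a < ?n \<Longrightarrow> decr y ! a = y $ e' a"
    "\<And>a b. a \<le> b \<Longrightarrow> b < ?n \<Longrightarrow> y $ e' b \<le> y $ e' a"
    using decr_enumeration[of y] by blast
  define p where "p = e \<circ> inv_into {..<?n} e'"
  have p: "bij p"
    unfolding p_def using e(1) e'(1) bij_betw_inv_into bij_betw_trans by blast
  have pe: "p (e' a) = e a" if "a < ?n" for a
    unfolding p_def using e'(1) that by (simp add: bij_betw_inv_into_left)
  have "F y \<le> F (\<chi> l. x $ p l)"
  proof (rule blending_mono_of_prefix_sums[OF F e'(1) y0 e'(3)])
    show "0 \<le> (\<chi> l. x $ p l) $ l" for l using x0 by simp
    have "(\<Sum>a<?n. y $ e' a) = (\<Sum>l\<in>UNIV. y $ l)"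
      using sum.reindex_bij_betw[OF e'(1)] .
    moreover have "(\<Sum>a<?n. x $ e a) = (\<Sum>l\<in>UNIV. x $ l)"
      using sum.reindex_bij_betw[OF e(1)] .
    ultimately show "(\<Sum>a<?n. (\<chi> l. x $ p l) $ e' a) = (\<Sum>a<?n. y $ e' a)"
      using maj pe unfolding majorizes_def by simp
    show "(\<Sum>a<m. y $ e' a) \<le> (\<Sum>a<m. (\<chi> l. x $ p l) $ e' a)" if "m < ?n" for m
    proof (cases "m = 0")
      case False
      then have "(\<Sum>a<m. decr y ! a) \<le> (\<Sum>a<m. decr x ! a)"
        using maj that unfolding majorizes_def by auto
      then show ?thesis
        using e(2) e'(2) pe that by simp
    qed simp
  qed
  also have "\<dots> = F x"
    by (rule blending_invariant_permutation[OF F x0 p])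
  finally show ?thesis .
qed

section \<open>Sums of powers of partial sums\<close>

lemma power_convex_combination:
  fixes a b t :: real
  assumes "0 \<le> a" "0 \<le> b" "0 \<le> t" "t \<le> 1"
  shows "((1 - t) * a + t * b) ^ k \<le> (1 - t) * a ^ k + t * b ^ k"
proof (induction k)
  case (Suc k)
  \<comment> \<open>In the induction step the two sides differ by \<open>t (1 - t) (a - b) (a\<^sup>k - b\<^sup>k)\<close>, and both
    differences have the same sign.\<close>
  have "0 \<le> (a - b) * (a ^ k - b ^ k)"
    using assms by (cases "a \<le> b") (auto simp: power_mono mult_nonpos_nonpos)
  then have "0 \<le> t * (1 - t) * ((a - b) * (a ^ k - b ^ k))"
    using assms by simp
  moreover have "((1 - t) * a + t * b) ^ Suc k \<le> ((1 - t) * a + t * b) * ((1 - t) * a ^ k + t * b ^ k)"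
    using Suc assms by (simp add: mult_left_mono)
  ultimately show ?case
    by (simp add: algebra_simps)
qed simp

text \<open>Each summand of \<open>M\<close> is convex, and the transposition only permutes the index sets.\<close>

lemma M_decreases_under_blending: "decreases_under_blending (M k r :: real ^ 'n \<Rightarrow> real)"
  unfolding decreases_under_blending_def
proof (intro allI impI)
  fix z :: "real ^ 'n" and t :: real and i j :: 'n
  assume z: "\<forall>l. 0 \<le> z $ l" and t: "0 \<le> t" "t \<le> 1"
  let ?s = "Transposition.transpose i j"
  let ?R = "{I. I \<subseteq> (UNIV :: 'n set) \<and> card I = r}"
  have inj: "inj ?s" by (rule inj_transpose)
  have swap: "(\<Sum>I\<in>?R. (\<Sum>l\<in>I. z $ ?s l) ^ k) = M k r z"
    unfolding M_def
    by (rule sum.reindex_bij_witness[of _ "image ?s" "image ?s"])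
      (use inj in \<open>auto simp: image_image card_image inj_on_subset sum.reindex\<close>)
  have "M k r (blend t i j z)
      = (\<Sum>I\<in>?R. ((1 - t) * (\<Sum>l\<in>I. z $ l) + t * (\<Sum>l\<in>I. z $ ?s l)) ^ k)"
    unfolding M_def blend_def by (simp add: sum.distrib sum_distrib_left)
  also have "\<dots> \<le> (\<Sum>I\<in>?R. (1 - t) * (\<Sum>l\<in>I. z $ l) ^ k + t * (\<Sum>l\<in>I. z $ ?s l) ^ k)"
    using z t by (intro sum_mono power_convex_combination sum_nonneg) auto
  also have "\<dots> = (1 - t) * M k r z + t * M k r z"
    unfolding sum.distrib sum_distrib_left[symmetric] swap by (simp add: M_def)
  finally show "M k r (blend t i j z) \<le> M k r z"
    by (simp add: algebra_simps)
qed

section \<open>Sums over exponents with many nonzero entries\<close>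

lemma binomial_divided_powers:
  fixes a b :: real
  shows "(\<Sum>u\<le>m. a ^ u / fact u * (b ^ (m - u) / fact (m - u))) = (a + b) ^ m / fact m"
  unfolding binomial_ring sum_divide_distrib
  by (intro sum.cong refl) (auto simp: binomial_fact)

text \<open>
  Here \<open>u\<close> and \<open>m - u\<close> are the exponents of the two blended entries, and \<open>c\<close> counts the nonzero
  exponents elsewhere. The set \<open>U\<close> is empty, all of \<open>{..m}\<close>, or \<open>{1..<m}\<close>; in the last case the
  terms \<open>a\<^sup>m\<close> and \<open>b\<^sup>m\<close> are missing from the binomial expansion of \<open>(a + b)\<^sup>m\<close>, and by
  convexity a blend does not increase their sum.
\<close>

lemma two_point_sum_le:
  fixes a b t :: real and m r c :: nat
  assumes ab: "0 \<le> a" "0 \<le> b" and t: "0 \<le> t" "t \<le> 1"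
  defines "a' \<equiv> (1 - t) * a + t * b" and "b' \<equiv> (1 - t) * b + t * a"
  defines "U \<equiv> {u. u \<le> m \<and> r \<le> c + (if u \<noteq> 0 then 1 else 0) + (if m - u \<noteq> 0 then 1 else (0::nat))}"
  shows "(\<Sum>u\<in>U. a ^ u / fact u * (b ^ (m - u) / fact (m - u)))
      \<le> (\<Sum>u\<in>U. a' ^ u / fact u * (b' ^ (m - u) / fact (m - u)))"
proof -
  let ?f = "\<lambda>a b u. a ^ u / fact u * (b ^ (m - u) / fact (m - u)) :: real"
  have s: "a' + b' = a + b"
    by (simp add: a'_def b'_def algebra_simps)
  have inner: "(\<Sum>u\<in>{1..<m}. ?f a b u) = ((a + b) ^ m - (a ^ m + b ^ m)) / fact m"
    if "1 \<le> m" for a b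
  proof -
    have "{..m} = insert 0 (insert m {1..<m})" using that by auto
    then have "(\<Sum>u\<le>m. ?f a b u) = ?f a b 0 + ?f a b m + (\<Sum>u\<in>{1..<m}. ?f a b u)"
      using that by simp
    then show ?thesis
      unfolding binomial_divided_powers by (simp add: field_simps)
  qed
  have "U = {} \<or> U = {..m} \<or> (U = {1..<m} \<and> 1 \<le> m)"
  proof -
    consider "r \<le> c" | "r = c + 1" "m = 0" | "r = c + 1" "m \<noteq> 0" | "r = c + 2" | "c + 2 < r" by linarith
    then show ?thesis
    proof cases
      case 4
      then have "U = {1..<m}" unfolding U_def by (auto split: if_splits)
      then show ?thesis by (cases m) auto
    qed (auto simp: U_def)
  qed
  then consider "U = {}" | "U = {..m}" | "U = {1..<m}" "1 \<le> m" by blast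
  then show ?thesis
  proof cases
    case 2
    then show ?thesis by (simp only: binomial_divided_powers s order_refl)
  next
    case 3
    have "a' ^ m + b' ^ m \<le> ((1 - t) * a ^ m + t * b ^ m) + ((1 - t) * b ^ m + t * a ^ m)"
      unfolding a'_def b'_def using ab t by (intro add_mono power_convex_combination)
    then have "a' ^ m + b' ^ m \<le> a ^ m + b ^ m"
      by (simp add: algebra_simps)
    then show ?thesis
      unfolding 3(1) inner[OF 3(2)] s by (intro divide_right_mono) simp_all
  qed simp
qed

text \<open>
  The map \<open>p \<mapsto> p(i := p i + p j, j := 0)\<close> groups the exponents by what they are outside \<open>{i, j}\<close> and
  by the total on \<open>{i, j}\<close>; each fiber is parametrized by \<open>u = p i\<close>.
\<close>

lemma G_fiber_sum:
  fixes z :: "real ^ 'n" and q :: "'n \<Rightarrow> nat"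
  assumes ij: "i \<noteq> j" and q: "q j = 0" "(\<Sum>l\<in>UNIV. q l) = k"
  shows "(\<Sum>p\<in>{p \<in> S k r. p(i := p i + p j, j := 0) = q}. \<Prod>l\<in>UNIV. (z $ l) ^ p l / fact (p l))
    = (\<Prod>l\<in>UNIV - {i, j}. (z $ l) ^ q l / fact (q l)) *
      (\<Sum>u\<in>{u. u \<le> q i \<and> r \<le> card {l. l \<noteq> i \<and> l \<noteq> j \<and> q l \<noteq> 0} + (if u \<noteq> 0 then 1 else 0)
              + (if q i - u \<noteq> 0 then 1 else (0::nat))}.
         (z $ i) ^ u / fact u * ((z $ j) ^ (q i - u) / fact (q i - u)))"
    (is "sum ?w ?P = ?R * sum ?f ?U")
proof -
  let ?c = "card {l. l \<noteq> i \<and> l \<noteq> j \<and> q l \<noteq> 0}"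
  let ?h = "\<lambda>u. q(i := u, j := q i - u)"
  have split_sum: "(\<Sum>l\<in>UNIV. p l) = p i + p j + (\<Sum>l\<in>UNIV - {i, j}. p l)" for p :: "'n \<Rightarrow> nat"
    using ij sum.subset_diff[of "{i, j}" UNIV p] by simp
  have split_card: "card {l. p l \<noteq> 0} = ?c + (if p i \<noteq> 0 then 1 else 0) + (if p j \<noteq> 0 then 1 else (0::nat))"
    if "\<And>l. l \<noteq> i \<Longrightarrow> l \<noteq> j \<Longrightarrow> p l = q l" for p :: "'n \<Rightarrow> nat"
  proof -
    have "p l \<noteq> 0 \<longleftrightarrow> l \<in> {l. l \<noteq> i \<and> l \<noteq> j \<and> q l \<noteq> 0} \<union> (if p i \<noteq> 0 then {i} else {}) \<union> (if p j \<noteq> 0 then {j} else {})" for l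
      using that[of l] by (cases "l = i"; cases "l = j") auto
    then have "{l. p l \<noteq> 0} = {l. l \<noteq> i \<and> l \<noteq> j \<and> q l \<noteq> 0} \<union> (if p i \<noteq> 0 then {i} else {}) \<union> (if p j \<noteq> 0 then {j} else {})"
      by blast
    then show ?thesis
      using ij by (auto simp: card_insert_if)
  qed
  have "sum ?w ?P = (\<Sum>u\<in>?U. ?R * ?f u)"
  proof (rule sum.reindex_bij_witness[of _ ?h "\<lambda>p. p i"])
    fix p assume "p \<in> ?P"
    then have p: "p \<in> S k r" and pq: "p(i := p i + p j, j := 0) = q" by auto
    have q_eq: "q l = (if l = i then p i + p j else if l = j then 0 else p l)" for l
      using fun_cong[OF pq, of l] ij by auto
    show "?h (p i) = p"
      using ij by (auto simp: fun_eq_iff q_eq)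
    show "p i \<in> ?U"
      using p split_card[of p] ij q_eq by (auto simp: S_def)
    have "?w p = (\<Prod>l\<in>{i, j}. (z $ l) ^ p l / fact (p l)) * (\<Prod>l\<in>UNIV - {i, j}. (z $ l) ^ p l / fact (p l))"
      by (subst prod.subset_diff[of "{i, j}" UNIV]) auto
    also have "(\<Prod>l\<in>UNIV - {i, j}. (z $ l) ^ p l / fact (p l)) = ?R"
      by (intro prod.cong) (auto simp: q_eq)
    finally show "?R * ?f (p i) = ?w p"
      using ij by (simp add: q_eq mult_ac)
  next
    fix u assume u: "u \<in> ?U"
    show "?h u i = u" using ij by simp
    have rest: "(\<Sum>l\<in>UNIV - {i, j}. ?h u l) = (\<Sum>l\<in>UNIV - {i, j}. q l)"
      by (intro sum.cong) auto
    have "(\<Sum>l\<in>UNIV. ?h u l) = k"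
      using u q ij split_sum[of "?h u"] split_sum[of q] rest by simp
    then show "?h u \<in> ?P"
      using u q ij split_card[of "?h u"] by (auto simp: S_def fun_eq_iff)
  qed
  then show ?thesis
    by (simp add: sum_distrib_left)
qed

text \<open>The vectors \<open>z\<close> and \<open>blend t i j z\<close> agree outside \<open>{i, j}\<close>, so fiber by fiber the two sums
  have the same nonnegative factor and are compared by \<open>two_point_sum_le\<close>.\<close>

lemma neg_G_decreases_under_blending:
  "decreases_under_blending (\<lambda>z :: real ^ 'n. - G k r z)"
  unfolding decreases_under_blending_def
proof (intro allI impI)
  fix z :: "real ^ 'n" and t :: real and i j :: 'n
  assume z: "\<forall>l. 0 \<le> z $ l" and t: "0 \<le> t" "t \<le> 1" and ij: "i \<noteq> j"
  let ?z = "blend t i j z"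
  let ?g = "\<lambda>p :: 'n \<Rightarrow> nat. p(i := p i + p j, j := 0)"
  have "G k r z \<le> G k r ?z"
    unfolding G_def sum.image_gen[OF finite_S, where g = ?g]
  proof (rule sum_mono)
    fix q assume "q \<in> ?g ` S k r"
    then obtain p where p: "(\<Sum>l\<in>UNIV. p l) = k" "q = ?g p"
      by (auto simp: S_def)
    have split_sum: "(\<Sum>l\<in>UNIV. p l) = p i + p j + (\<Sum>l\<in>UNIV - {i, j}. p l)" for p :: "'n \<Rightarrow> nat"
      using ij sum.subset_diff[of "{i, j}" UNIV p] by simp
    have "(\<Sum>l\<in>UNIV - {i, j}. q l) = (\<Sum>l\<in>UNIV - {i, j}. p l)"
      unfolding p(2) by (intro sum.cong) auto
    moreover have q_ij: "q i = p i + p j" "q j = 0"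
      using p(2) ij by auto
    ultimately have q: "q j = 0" "(\<Sum>l\<in>UNIV. q l) = k"
      using p(1) split_sum[of q] split_sum[of p] by simp_all
    have rest: "(\<Prod>l\<in>UNIV - {i, j}. (?z $ l) ^ q l / fact (q l))
        = (\<Prod>l\<in>UNIV - {i, j}. (z $ l) ^ q l / fact (q l))"
      using blend_nth_eq(3)[OF ij] by (intro prod.cong) auto
    show "(\<Sum>p\<in>{p \<in> S k r. ?g p = q}. \<Prod>l\<in>UNIV. (z $ l) ^ p l / fact (p l))
        \<le> (\<Sum>p\<in>{p \<in> S k r. ?g p = q}. \<Prod>l\<in>UNIV. (?z $ l) ^ p l / fact (p l))"
      unfolding G_fiber_sum[OF ij q] rest blend_nth_eq(1,2)[OF ij]
      using z t by (intro mult_left_mono two_point_sum_le prod_nonneg) auto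
  qed
  then show "- G k r ?z \<le> - G k r z" by simp
qed

section \<open>Exponents with few nonzero entries\<close>

definition exponents_within :: "'n :: finite set \<Rightarrow> nat \<Rightarrow> ('n \<Rightarrow> nat) set" where
  "exponents_within I k = {p. (\<forall>l. l \<notin> I \<longrightarrow> p l = 0) \<and> (\<Sum>l\<in>UNIV. p l) = k}"

lemma finite_exponents_within: "finite (exponents_within I k)"
  by (rule finite_subset[OF _ finite_S[of k 0]]) (auto simp: exponents_within_def S_def)

text \<open>The multinomial theorem, by induction on \<open>I\<close>: splitting off the exponent \<open>m\<close> of a new index
  \<open>j\<close> leaves the binomial expansion of \<open>(x\<^sub>j + (\<Sum>l\<in>I. x\<^sub>l))\<^sup>k\<close>.\<close>

lemma multinomial_divided_powers:
  fixes x :: "real ^ 'n"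
  shows "(\<Sum>p\<in>exponents_within I k. \<Prod>l\<in>UNIV. (x $ l) ^ p l / fact (p l)) = (\<Sum>l\<in>I. x $ l) ^ k / fact k"
proof -
  have "finite I" by simp
  then show ?thesis
  proof (induction I arbitrary: k rule: finite_induct)
    case empty
    have "exponents_within {} k = (if k = 0 then {\<lambda>_. 0} else ({} :: ('n \<Rightarrow> nat) set))"
      by (auto simp: exponents_within_def fun_eq_iff)
    then show ?case by simp
  next
    case (insert j I)
    let ?w = "\<lambda>p. \<Prod>l\<in>UNIV. (x $ l) ^ p l / fact (p l)"
    have sum_upd: "(\<Sum>l\<in>UNIV. (p(j := m)) l) + p j = (\<Sum>l\<in>UNIV. p l) + m" for p :: "'n \<Rightarrow> nat" and m
    proof -
      have "(\<Sum>l\<in>UNIV - {j}. (p(j := m)) l) = (\<Sum>l\<in>UNIV - {j}. p l)"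
        by (intro sum.cong) auto
      then show ?thesis
        using sum.remove[of UNIV j "p(j := m)"] sum.remove[of UNIV j p] by simp
    qed
    have w_upd: "?w (p(j := m)) = (x $ j) ^ m / fact m * ?w p" if "p j = 0" for p m
    proof -
      have "(\<Prod>l\<in>UNIV - {j}. (x $ l) ^ (p(j := m)) l / fact ((p(j := m)) l))
          = (\<Prod>l\<in>UNIV - {j}. (x $ l) ^ p l / fact (p l))"
        by (intro prod.cong) auto
      then show ?thesis
        using prod.remove[of UNIV j "\<lambda>l. (x $ l) ^ (p(j := m)) l / fact ((p(j := m)) l)"]
          prod.remove[of UNIV j "\<lambda>l. (x $ l) ^ p l / fact (p l)"] that by simp
    qed
    have "sum ?w (exponents_within (insert j I) k)
        = (\<Sum>(m, p)\<in>(SIGMA m:{..k}. exponents_within I (k - m)). (x $ j) ^ m / fact m * ?w p)"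
    proof (rule sum.reindex_bij_witness[of _ "\<lambda>(m, p). p(j := m)" "\<lambda>p. (p j, p(j := 0))"])
      fix p assume p: "p \<in> exponents_within (insert j I) k"
      then have "p j \<le> k"
        using member_le_sum[of j UNIV p] by (auto simp: exponents_within_def)
      moreover have "(\<Sum>l\<in>UNIV. (p(j := 0)) l) = k - p j"
        using sum_upd[of p 0] p by (simp add: exponents_within_def)
      ultimately show "(p j, p(j := 0)) \<in> (SIGMA m:{..k}. exponents_within I (k - m))"
        using p by (auto simp: exponents_within_def)
      show "(case (p j, p(j := 0)) of (m, p) \<Rightarrow> (x $ j) ^ m / fact m * ?w p) = ?w p"
        using w_upd[of "p(j := 0)" "p j"] by simp
    next
      fix mp assume mp: "mp \<in> (SIGMA m:{..k}. exponents_within I (k - m))"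
      obtain m p where [simp]: "mp = (m, p)" by force
      have m: "m \<le> k" and p: "p \<in> exponents_within I (k - m)" using mp by auto
      have pj: "p j = 0" using p insert.hyps by (auto simp: exponents_within_def)
      have "(\<Sum>l\<in>UNIV. (p(j := m)) l) = k"
        using sum_upd[of p m] m p pj by (simp add: exponents_within_def)
      then show "(case mp of (m, p) \<Rightarrow> p(j := m)) \<in> exponents_within (insert j I) k"
        using p by (auto simp: exponents_within_def)
      show "(\<lambda>p. (p j, p(j := 0))) (case mp of (m, p) \<Rightarrow> p(j := m)) = mp"
        using pj by (auto simp: fun_eq_iff)
    qed auto
    also have "\<dots> = (\<Sum>m\<le>k. \<Sum>p\<in>exponents_within I (k - m). (x $ j) ^ m / fact m * ?w p)"
      by (subst sum.Sigma) (auto simp: finite_exponents_within)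
    also have "\<dots> = (\<Sum>m\<le>k. (x $ j) ^ m / fact m * ((\<Sum>l\<in>I. x $ l) ^ (k - m) / fact (k - m)))"
      by (simp only: sum_distrib_left[symmetric] insert.IH)
    also have "\<dots> = (\<Sum>l\<in>insert j I. x $ l) ^ k / fact k"
      by (simp only: binomial_divided_powers sum.insert[OF insert.hyps])
    finally show ?case .
  qed
qed

lemma G_complement:
  fixes x :: "real ^ 'n"
  shows "G k (Suc r) x = (\<Sum>l\<in>UNIV. x $ l) ^ k / fact k
    - (\<Sum>p | (\<Sum>l\<in>UNIV. p l) = k \<and> card {l. p l \<noteq> 0} \<le> r. \<Prod>l\<in>UNIV. (x $ l) ^ p l / fact (p l))"
    (is "_ = _ - sum ?w ?L")
proof -
  have eq: "exponents_within UNIV k = S k (Suc r) \<union> ?L"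
    by (auto simp: exponents_within_def S_def)
  have "sum ?w (exponents_within UNIV k) = sum ?w (S k (Suc r)) + sum ?w ?L"
    unfolding eq
  proof (rule sum.union_disjoint)
    show "finite ?L"
      by (rule finite_subset[OF _ finite_exponents_within[of UNIV k]]) (simp only: eq Un_upper2)
  qed (rule finite_S, auto simp: S_def)
  then show ?thesis
    unfolding multinomial_divided_powers G_def by simp
qed

text \<open>An exponent supported in an \<open>r\<close>-element set has at most \<open>r\<close> nonzero entries, which gives the
  lower bound. Conversely, each exponent with at most \<open>r\<close> nonzero entries is supported in some
  \<open>r\<close>-element set, possibly in several; counting it once for each of them gives the upper bound.\<close>

lemma few_nonzero_bounds:
  fixes x :: "real ^ 'n" and k r :: nat
  assumes x: "\<And>l. 0 \<le> x $ l"
  defines "H \<equiv> (\<Sum>p | (\<Sum>l\<in>UNIV. p l) = k \<and> card {l. p l \<noteq> 0} \<le> r. \<Prod>l\<in>UNIV. (x $ l) ^ p l / fact (p l))"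
  shows "card I = r \<Longrightarrow> (\<Sum>l\<in>I. x $ l) ^ k / fact k \<le> H"
    and "r \<le> CARD('n) \<Longrightarrow> H \<le> M k r x / fact k"
proof -
  let ?L = "{p :: 'n \<Rightarrow> nat. (\<Sum>l\<in>UNIV. p l) = k \<and> card {l. p l \<noteq> 0} \<le> r}"
  let ?w = "\<lambda>p. \<Prod>l\<in>UNIV. (x $ l) ^ p l / fact (p l)"
  have w: "0 \<le> ?w p" for p using x by (intro prod_nonneg) auto
  have fin: "finite ?L"
    by (rule finite_subset[OF _ finite_S[of k 0]]) (auto simp: S_def)
  show "(\<Sum>l\<in>I. x $ l) ^ k / fact k \<le> H" if I: "card I = r"
    unfolding H_def multinomial_divided_powers[symmetric]
  proof (rule sum_mono2[OF fin])
    have "card {l. p l \<noteq> 0} \<le> r" if "p \<in> exponents_within I k" for p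
      unfolding I[symmetric] by (rule card_mono) (use that in \<open>auto simp: exponents_within_def\<close>)
    then show "exponents_within I k \<subseteq> ?L"
      by (auto simp: exponents_within_def)
  qed (rule w)
  show "H \<le> M k r x / fact k" if r: "r \<le> CARD('n)"
  proof -
    let ?R = "{I. I \<subseteq> (UNIV :: 'n set) \<and> card I = r}"
    have "H \<le> (\<Sum>(I, p)\<in>(SIGMA I:?R. exponents_within I k). ?w p)"
      unfolding H_def
    proof (rule sum_le_included[OF fin, where i = snd])
      show "\<forall>p\<in>?L. \<exists>Ip\<in>(SIGMA I:?R. exponents_within I k). snd Ip = p \<and> ?w p \<le> (case Ip of (I, p) \<Rightarrow> ?w p)"
      proof
        fix p assume p: "p \<in> ?L"
        then obtain I where "{l. p l \<noteq> 0} \<subseteq> I" "card I = r"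
          using exists_subset_between[of "{l. p l \<noteq> 0}" r UNIV] r by auto
        then show "\<exists>Ip\<in>(SIGMA I:?R. exponents_within I k). snd Ip = p \<and> ?w p \<le> (case Ip of (I, p) \<Rightarrow> ?w p)"
          using p by (intro bexI[of _ "(I, p)"]) (auto simp: exponents_within_def)
      qed
    qed (auto simp: finite_exponents_within w)
    also have "\<dots> = (\<Sum>I\<in>?R. \<Sum>p\<in>exponents_within I k. ?w p)"
      by (subst sum.Sigma) (auto simp: finite_exponents_within)
    also have "\<dots> = M k r x / fact k"
      unfolding multinomial_divided_powers M_def by (simp add: sum_divide_distrib)
    finally show ?thesis .
  qed
qed

section \<open>Majorization from bounds on large powers\<close>

lemma le_of_power_le_const_mult_power:
  fixes u T N :: real
  assumes "0 \<le> T" and le: "\<And>k. 1 \<le> k \<Longrightarrow> u ^ k \<le> N * T ^ k"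
  shows "u \<le> T"
proof (rule ccontr)
  assume "\<not> ?thesis"
  then have "T < u" by simp
  then have "T \<noteq> 0" using le[of 1] by auto
  then have T: "0 < T" using assms by simp
  then obtain k where k: "max N 1 < (u / T) ^ k"
    using real_arch_pow[of "u / T" "max N 1"] \<open>T < u\<close> by auto
  then have "k \<noteq> 0" by (cases k) auto
  then have "(u / T) ^ k \<le> N"
    using le[of k] T by (simp add: power_divide field_simps)
  then show False using k by simp
qed

text \<open>Outside their intersection, \<open>K\<close> and \<open>{..<card K}\<close> have equally many elements, and the value
  \<open>f (card K - 1)\<close> separates the values of \<open>f\<close> on the two remainders.\<close>

lemma sum_le_sum_initial:
  fixes f :: "nat \<Rightarrow> real"
  assumes f: "\<And>a b. a \<le> b \<Longrightarrow> b < n \<Longrightarrow> f b \<le> f a" and K: "K \<subseteq> {..<n}"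
  shows "sum f K \<le> (\<Sum>a<card K. f a)"
proof -
  let ?r = "card K"
  have fin: "finite K" using K finite_subset by blast
  have rn: "?r \<le> n" using card_mono[OF _ K] by simp
  have same_card: "card (K - {..<?r}) = card ({..<?r} - K)"
    using card_Diff_subset_Int[of K "{..<?r}"] card_Diff_subset_Int[of "{..<?r}" K] fin
    by (simp add: Int_commute)
  have "sum f (K - {..<?r}) \<le> sum f ({..<?r} - K)"
  proof (cases "?r = 0")
    case False
    have "sum f (K - {..<?r}) \<le> of_nat (card (K - {..<?r})) * f (?r - 1)"
      using f K False by (intro sum_bounded_above) auto
    also have "\<dots> \<le> sum f ({..<?r} - K)"
      unfolding same_card using f rn False by (intro sum_bounded_below) auto
    finally show ?thesis .
  qed (use fin in auto)
  moreover have "sum f K = sum f (K \<inter> {..<?r}) + sum f (K - {..<?r})"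
    using fin by (rule sum.Int_Diff)
  moreover have "sum f {..<?r} = sum f ({..<?r} \<inter> K) + sum f ({..<?r} - K)"
    by (rule sum.Int_Diff) simp
  ultimately show ?thesis by (simp add: Int_commute)
qed

lemma sum_le_decr_prefix:
  fixes x :: "real ^ 'n"
  shows "(\<Sum>l\<in>I. x $ l) \<le> (\<Sum>a<card I. decr x ! a)"
proof -
  let ?n = "CARD('n)"
  obtain e where e: "bij_betw e {..<?n} UNIV" "\<And>a. a < ?n \<Longrightarrow> decr x ! a = x $ e a"
    "\<And>a b. a \<le> b \<Longrightarrow> b < ?n \<Longrightarrow> x $ e b \<le> x $ e a"
    using decr_enumeration[of x] by blast
  let ?K = "{a \<in> {..<?n}. e a \<in> I}"
  have K: "bij_betw e ?K I"
  proof (rule bij_betw_subset[OF e(1)])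
    show "e ` ?K = I"
    proof (intro equalityI subsetI)
      fix l assume "l \<in> I"
      moreover have "l \<in> e ` {..<?n}"
        using bij_betw_imp_surj_on[OF e(1)] by simp
      ultimately show "l \<in> e ` ?K" by auto
    qed auto
  qed auto
  have "card I \<le> ?n" by (rule card_mono) auto
  then have "(\<Sum>a<card I. decr x ! a) = (\<Sum>a<card I. x $ e a)"
    using e(2) by (intro sum.cong) auto
  moreover have "(\<Sum>l\<in>I. x $ l) = (\<Sum>a\<in>?K. x $ e a)"
    by (rule sum.reindex_bij_betw[OF K, symmetric])
  moreover have "(\<Sum>a\<in>?K. x $ e a) \<le> (\<Sum>a<card ?K. x $ e a)"
    by (rule sum_le_sum_initial[of ?n]) (use e(3) in auto)
  ultimately show ?thesis
    using bij_betw_same_card[OF K] by simp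
qed

lemma decr_prefix_attained:
  fixes x :: "real ^ 'n"
  assumes "r \<le> CARD('n)"
  obtains I where "card I = r" "(\<Sum>l\<in>I. x $ l) = (\<Sum>a<r. decr x ! a)"
proof -
  obtain e where e: "bij_betw e {..<CARD('n)} UNIV" "\<And>a. a < CARD('n) \<Longrightarrow> decr x ! a = x $ e a"
    "\<And>a b. a \<le> b \<Longrightarrow> b < CARD('n) \<Longrightarrow> x $ e b \<le> x $ e a"
    using decr_enumeration[of x] by blast
  have inj: "inj_on e {..<r}"
    by (rule inj_on_subset[OF bij_betw_imp_inj_on[OF e(1)]]) (use assms in auto)
  show thesis
  proof (rule that[of "e ` {..<r}"])
    show "card (e ` {..<r}) = r" using inj by (simp add: card_image)
    show "(\<Sum>l\<in>e ` {..<r}. x $ l) = (\<Sum>a<r. decr x ! a)"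
      using inj e(2) assms by (simp add: sum.reindex)
  qed
qed

text \<open>Choose \<open>I\<close> to carry the \<open>r\<close> largest entries of \<open>y\<close>. With \<open>T\<close> the sum of the \<open>r\<close> largest
  entries of \<open>x\<close>, each summand of \<open>M k r x\<close> is at most \<open>T\<^sup>k\<close>, and the number of summands does not
  depend on \<open>k\<close>.\<close>

lemma majorization_of_power_bounds:
  fixes x y :: "real ^ 'n"
  assumes x: "\<And>l. 0 \<le> x $ l" and tot: "(\<Sum>l\<in>UNIV. x $ l) = (\<Sum>l\<in>UNIV. y $ l)"
    and le: "\<And>k r I. 1 \<le> k \<Longrightarrow> 1 \<le> r \<Longrightarrow> r < CARD('n) \<Longrightarrow> card I = r \<Longrightarrow> (\<Sum>l\<in>I. y $ l) ^ k \<le> M k r x"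
  shows "x \<succ> y"
  unfolding majorizes_def
proof (intro conjI ballI tot)
  fix r assume r: "r \<in> {1..<CARD('n)}"
  let ?R = "{I. I \<subseteq> (UNIV :: 'n set) \<and> card I = r}"
  let ?T = "\<Sum>a<r. decr x ! a"
  obtain I where I: "card I = r" "(\<Sum>l\<in>I. y $ l) = (\<Sum>a<r. decr y ! a)"
    using decr_prefix_attained[of r y] r by auto
  have T: "(\<Sum>l\<in>J. x $ l) \<le> ?T" if "card J = r" for J
    using sum_le_decr_prefix[of x J] that by simp
  have "0 \<le> ?T"
    using T[OF I(1)] sum_nonneg[of I "\<lambda>l. x $ l"] x by (meson order_trans)
  then show "(\<Sum>a<r. decr y ! a) \<le> ?T"
  proof (rule le_of_power_le_const_mult_power)
    fix k :: nat assume k: "1 \<le> k"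
    have "M k r x \<le> (\<Sum>J\<in>?R. ?T ^ k)"
      unfolding M_def using T x by (intro sum_mono power_mono sum_nonneg) auto
    then show "(\<Sum>a<r. decr y ! a) ^ k \<le> real (card ?R) * ?T ^ k"
      using le[OF k _ _ I(1)] r unfolding I(2) by simp
  qed
qed

theorem theorem2:
  fixes x y :: "real ^ 'n"
  assumes "\<And>i. x $ i \<ge> 0" and "\<And>i. y $ i \<ge> 0"
    and "(\<Sum>i\<in>UNIV. x $ i) = (\<Sum>i\<in>UNIV. y $ i)"
  shows "(x \<succ> y \<longleftrightarrow> (\<forall>k\<ge>1. \<forall>r\<ge>1. G k r x \<le> G k r y)) \<and>
         (x \<succ> y \<longleftrightarrow> (\<forall>k\<ge>1. \<forall>r\<ge>1. M k r x \<ge> M k r y))"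
proof (intro conjI iffI allI impI)
  show "G k r x \<le> G k r y" if "x \<succ> y" for k r
    using majorization_imp_blending_le[OF neg_G_decreases_under_blending assms(1,2) that, of k r] by simp
  show "M k r y \<le> M k r x" if "x \<succ> y" for k r
    by (rule majorization_imp_blending_le[OF M_decreases_under_blending assms(1,2) that])
  show "x \<succ> y" if GG: "\<forall>k\<ge>1. \<forall>r\<ge>1. G k r x \<le> G k r y"
  proof (rule majorization_of_power_bounds[OF assms(1,3)])
    fix k r :: nat and I :: "'n set"
    assume k: "1 \<le> k" and r: "r < CARD('n)" and I: "card I = r"
    let ?H = "\<lambda>z :: real ^ 'n. \<Sum>p | (\<Sum>l\<in>UNIV. p l) = k \<and> card {l. p l \<noteq> 0} \<le> r.
      \<Prod>l\<in>UNIV. (z $ l) ^ p l / fact (p l)"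
    have "(\<Sum>l\<in>I. y $ l) ^ k / fact k \<le> ?H y"
      by (rule few_nonzero_bounds(1)[OF assms(2) I])
    \<comment> \<open>The omitted part \<open>?H\<close> and \<open>G k (r + 1)\<close> add up to a quantity on which \<open>x\<close> and \<open>y\<close> agree,
      so the inequality reverses.\<close>
    also have "\<dots> \<le> ?H x"
    proof -
      have "G k (Suc r) x \<le> G k (Suc r) y" using GG k by simp
      then show ?thesis unfolding G_complement assms(3) by simp
    qed
    also have "\<dots> \<le> M k r x / fact k"
      using few_nonzero_bounds(2)[OF assms(1)] r by simp
    finally show "(\<Sum>l\<in>I. y $ l) ^ k \<le> M k r x"
      by (simp add: divide_le_cancel)
  qed
  show "x \<succ> y" if MM: "\<forall>k\<ge>1. \<forall>r\<ge>1. M k r y \<le> M k r x"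
  proof (rule majorization_of_power_bounds[OF assms(1,3)])
    fix k r :: nat and I :: "'n set"
    assume k: "1 \<le> k" and r: "1 \<le> r" and I: "card I = r"
    have "(\<Sum>l\<in>I. y $ l) ^ k \<le> M k r y"
      unfolding M_def
      by (rule member_le_sum[of I _ "\<lambda>I. (\<Sum>l\<in>I. y $ l) ^ k"]) (use I assms(2) in \<open>auto intro!: zero_le_power sum_nonneg\<close>)
    also have "\<dots> \<le> M k r x" using MM k r by simp
    finally show "(\<Sum>l\<in>I. y $ l) ^ k \<le> M k r x" .
  qed
qed

end
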